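(* For every $N\ge 1$ and all finite nonempty input sets $\mathcal{A}_1,\dots,\mathcal{A}_N$ (with $\bm{\mathcal{A}}=\mathcal{A}_1\times\cdots\times\mathcal{A}_N$), $$\mathcal{C}_N(\bm{\mathcal{A}};[2])=\mathfrak{I}_N(\bm{\mathcal{A}};[2]),$$ where $[2]=\{0,1\}$.
   Context: A multiple access channel (MAC) $\bm{\mathcal{A}}\to\mathcal{B}$ is a family of conditional probabilities $p(b|a_1\cdots a_N)\ge 0$, $b\in\mathcal{B}$, $a_i\in\mathcal{A}_i$, with $\sum_b p(b|a_1\cdots a_N)=1$ for every input. $N$-local classical MACs (generated by a single classical particle): let $0,\mathbf{e}_1,\dots,\mathbf{e}_N$ be $N+1$ distinct symbols ("no particle" and "particle received on path $i$"). $\mathcal{C}_N(\bm{\mathcal{A}};\mathcal{B})$ is the set of MACs of the form $$p(b|a_1\cdots a_N)=\sum_{i=1}^N p_i\left[d(b|0)\,q_i(0|a_i)+d(b|\mathbf{e}_i)\,q_i(\mathbf{e}_i|a_i)\right],$$ where $(p_i)$ is a probability distribution, each $q_i$ is a stochastic map $\mathcal{A}_i\to\{0,\mathbf{e}_i\}$, and $d$ is a stochastic map $\{0,\mathbf{e}_1,\dots,\mathbf{e}_N\}\to\mathcal{B}$ (the same $d$ for all $i$). Second-order interference: for a MAC $\mathbf{p}$ and $i\neq j$, let $\mathcal{M}^{(i,j)}(\mathbf{p})$ be the set of two-sender MACs $p(b|a_i,a_j)$ obtained from $\mathbf{p}$ by fixing the inputs $a_k$ of all senders $k\ne i,j$ to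 arbitrary values. Put $$I_2^{(i,j)}(\mathbf{p})=\max\left|p(b|a_i,a_j)+p(b|a_i',a_j')-p(b|a_i,a_j')-p(b|a_i',a_j)\right|,$$ the maximum being over all two-sender MACs in $\mathcal{M}^{(i,j)}(\mathbf{p})$, all $b\in\mathcal{B}$, $a_i,a_i'\in\mathcal{A}_i$, $a_j,a_j'\in\mathcal{A}_j$. $\mathfrak{I}_N(\bm{\mathcal{A}};\mathcal{B})$ is the set of all MACs $\mathbf{p}:\bm{\mathcal{A}}\to\mathcal{B}$ with $I_2^{(i,j)}(\mathbf{p})=0$ for all pairs $i\ne j$. *)

theory Defs
  imports Complex_Main "HOL-Library.FuncSet"
begin

text \<open>
  Distributions, stochastic maps and channels are extensional functions, so that equality
  of channels means equality on all admissible inputs and outputs. The kernel value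
  \<open>K x y\<close> is what is written \<open>K(y|x)\<close> in the literature.
\<close>

definition prob_dists :: "'s set \<Rightarrow> ('s \<Rightarrow> real) set" where
  "prob_dists S = {w \<in> extensional S. (\<forall>s\<in>S. 0 \<le> w s) \<and> (\<Sum>s\<in>S. w s) = 1}"

definition stochastic_maps :: "'x set \<Rightarrow> 'y set \<Rightarrow> ('x \<Rightarrow> 'y \<Rightarrow> real) set" where
  "stochastic_maps X Y = X \<rightarrow>\<^sub>E prob_dists Y"

text \<open>
  The senders are \<open>1, \<dots>, N\<close>; sender \<open>i\<close> has input set \<open>A i\<close>, a subset of a common type.
\<close>

definition inputs :: "nat \<Rightarrow> (nat \<Rightarrow> 'a set) \<Rightarrow> (nat \<Rightarrow> 'a) set" where
  "inputs N A = (\<Pi>\<^sub>E i\<in>{1..N}. A i)"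

definition MACs :: "nat \<Rightarrow> (nat \<Rightarrow> 'a set) \<Rightarrow> 'b set \<Rightarrow> ((nat \<Rightarrow> 'a) \<Rightarrow> 'b \<Rightarrow> real) set" where
  "MACs N A B = stochastic_maps (inputs N A) B"

text \<open>\<open>Vac\<close> is the symbol 0 (no particle), \<open>Path i\<close> is \<open>e\<^sub>i\<close> (particle received on path \<open>i\<close>).\<close>

datatype signal = Vac | Path nat

definition local_MACs ::
  "nat \<Rightarrow> (nat \<Rightarrow> 'a set) \<Rightarrow> 'b set \<Rightarrow> ((nat \<Rightarrow> 'a) \<Rightarrow> 'b \<Rightarrow> real) set" where
  "local_MACs N A B = {p \<in> MACs N A B. \<exists>w q d.
     w \<in> prob_dists {1..N} \<and>
     (\<forall>i\<in>{1..N}. q i \<in> stochastic_maps (A i) {Vac, Path i}) \<and>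
     d \<in> stochastic_maps (insert Vac (Path ` {1..N})) B \<and>
     (\<forall>a\<in>inputs N A. \<forall>b\<in>B.
        p a b = (\<Sum>i=1..N. w i * (d Vac b * q i (a i) Vac + d (Path i) b * q i (a i) (Path i))))}"

definition two_sender_MACs ::
  "nat \<Rightarrow> (nat \<Rightarrow> 'a set) \<Rightarrow> nat \<Rightarrow> nat \<Rightarrow> ((nat \<Rightarrow> 'a) \<Rightarrow> 'b \<Rightarrow> real) \<Rightarrow>
     ('a \<Rightarrow> 'a \<Rightarrow> 'b \<Rightarrow> real) set" where
  "two_sender_MACs N A i j p =
     {(\<lambda>x\<in>A i. \<lambda>y\<in>A j. p (c(i := x, j := y))) | c. c \<in> (\<Pi>\<^sub>E k\<in>{1..N} - {i, j}. A k)}"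

definition I2 ::
  "nat \<Rightarrow> (nat \<Rightarrow> 'a set) \<Rightarrow> 'b set \<Rightarrow> nat \<Rightarrow> nat \<Rightarrow> ((nat \<Rightarrow> 'a) \<Rightarrow> 'b \<Rightarrow> real) \<Rightarrow> real" where
  "I2 N A B i j p = Max {\<bar>m x y b + m x' y' b - m x y' b - m x' y b\<bar> | m b x x' y y'.
     m \<in> two_sender_MACs N A i j p \<and> b \<in> B \<and> x \<in> A i \<and> x' \<in> A i \<and> y \<in> A j \<and> y' \<in> A j}"

definition no_interference_MACs ::
  "nat \<Rightarrow> (nat \<Rightarrow> 'a set) \<Rightarrow> 'b set \<Rightarrow> ((nat \<Rightarrow> 'a) \<Rightarrow> 'b \<Rightarrow> real) set" where
  "no_interference_MACs N A B =
     {p \<in> MACs N A B. \<forall>i\<in>{1..N}. \<forall>j\<in>{1..N}. i \<noteq> j \<longrightarrow> I2 N A B i j p = 0}"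

end

theory Submission
  imports Defs
begin

text \<open>
  Vanishing second-order interference says that the mixed second differences of \<open>p\<close> vanish,
  which is equivalent to \<open>p\<close> being a sum of functions of one input each. Such a sum is
  realised by a single particle as follows. Let \<open>f a = p(1|a)\<close>, let \<open>e\<close> minimise \<open>f\<close>, and write
  \<open>f a = f e + (\<Sum>i. h i (a i))\<close> with \<open>h i \<ge> 0\<close>. Let the receiver output 1 exactly if the
  particle arrives. Path \<open>i\<close> must then carry weight at least \<open>max (h i)\<close>, and these maxima sum
  to \<open>max f - f e \<le> 1 - f e\<close>. The constant \<open>f e\<close> and the weight left over are assigned to
  the first path.
\<close>

text \<open>Moving from \<open>e\<close> to \<open>a\<close> one coordinate at a time, the sum
  telescopes: a vanishing mixed difference says that the increment from changing coordinate
  \<open>i\<close> does not depend on which other coordinates have already been changed.\<close>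

lemma vanishing_mixed_differences_imp_additive:
  fixes f :: "('i \<Rightarrow> 'a) \<Rightarrow> real"
  assumes "finite I"
    and mixed: "\<And>c i j x y. \<lbrakk>c \<in> Pi\<^sub>E I A; i \<in> I; j \<in> I; i \<noteq> j; x \<in> A i; y \<in> A j\<rbrakk>
      \<Longrightarrow> f (c(i := x, j := y)) + f c = f (c(i := x)) + f (c(j := y))"
    and a: "a \<in> Pi\<^sub>E I A" and e: "e \<in> Pi\<^sub>E I A"
  shows "f a = f e + (\<Sum>i\<in>I. f (e(i := a i)) - f e)"
proof -
  \<comment> \<open>\<open>g K\<close> is the intermediate point at which exactly the coordinates in
    \<open>K\<close> have been switched from \<open>e\<close> to \<open>a\<close>.\<close>
  define g where "g K = (\<lambda>k. if k \<in> K then a k else e k)" for K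
  have g_in: "g K \<in> Pi\<^sub>E I A" for K
    using a e by (auto simp: g_def PiE_iff extensional_def)
  have g_insert: "g (insert j K) = (g K)(j := a j)" for j K
    by (auto simp: g_def fun_eq_iff)
  have g_empty: "g {} = e"
    by (simp add: g_def)
  have step: "f ((g K)(i := a i)) - f (g K) = f (e(i := a i)) - f e"
    if "finite K" "K \<subseteq> I" "i \<in> I" "i \<notin> K" for i K
    using that
  proof (induction K rule: finite_induct)
    case empty
    then show ?case by (simp add: g_empty)
  next
    case (insert j K)
    \<comment> \<open>At base point \<open>g K\<close>, the increment in direction \<open>i\<close>
      is the same before and after switching \<open>j\<close>.\<close>
    then have "f ((g K)(j := a j, i := a i)) + f (g K) = f ((g K)(j := a j)) + f ((g K)(i := a i))"
      using a by (intro mixed g_in) auto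
    moreover have "f ((g K)(i := a i)) - f (g K) = f (e(i := a i)) - f e"
      using insert by blast
    ultimately show ?case
      unfolding g_insert by linarith
  qed
  have "f (g K) = f e + (\<Sum>i\<in>K. f (e(i := a i)) - f e)" if "finite K" "K \<subseteq> I" for K
    using that
  proof (induction K rule: finite_induct)
    case empty
    then show ?case by (simp add: g_empty)
  next
    case (insert j K)
    then have "f (g K) = f e + (\<Sum>i\<in>K. f (e(i := a i)) - f e)"
      and "f ((g K)(j := a j)) - f (g K) = f (e(j := a j)) - f e"
      by (blast, intro step) auto
    then show ?case
      unfolding g_insert sum.insert[OF insert.hyps] by linarith
  qed
  from this[of I] have "f (g I) = f e + (\<Sum>i\<in>I. f (e(i := a i)) - f e)"
    using \<open>finite I\<close> by simp
  moreover have "g I = a"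
    using a e by (auto simp: g_def fun_eq_iff PiE_iff extensional_def)
  ultimately show ?thesis by simp
qed

lemma two_sender_MACs_apply:
  assumes "m \<in> two_sender_MACs N A i j p"
  obtains c where "c \<in> (\<Pi>\<^sub>E k\<in>{1..N} - {i, j}. A k)"
    and "\<And>x y. x \<in> A i \<Longrightarrow> y \<in> A j \<Longrightarrow> m x y = p (c(i := x, j := y))"
proof -
  from assms obtain c where "c \<in> (\<Pi>\<^sub>E k\<in>{1..N} - {i, j}. A k)"
    and "m = (\<lambda>x\<in>A i. \<lambda>y\<in>A j. p (c(i := x, j := y)))"
    unfolding two_sender_MACs_def by blast
  then show thesis
    by (intro that[of c]) simp_all
qed

text \<open>Each summand sees a single input, so it occurs in the mixed difference twice with each
  sign, or is constant there, and cancels.\<close>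

lemma I2_eq_0_if_additive:
  fixes g :: "'b \<Rightarrow> nat \<Rightarrow> 'a \<Rightarrow> real"
  assumes add: "\<And>a b. a \<in> inputs N A \<Longrightarrow> b \<in> B \<Longrightarrow> p a b = (\<Sum>k=1..N. g b k (a k))"
    and ij: "i \<in> {1..N}" "j \<in> {1..N}" "i \<noteq> j"
    and A: "\<And>k. k \<in> {1..N} \<Longrightarrow> A k \<noteq> {}" and "B \<noteq> {}"
  shows "I2 N A B i j p = 0"
proof -
  define S where "S = {\<bar>m x y b + m x' y' b - m x y' b - m x' y b\<bar> | m b x x' y y'.
     m \<in> two_sender_MACs N A i j p \<and> b \<in> B \<and> x \<in> A i \<and> x' \<in> A i \<and> y \<in> A j \<and> y' \<in> A j}"
  have "s = 0" if "s \<in> S" for s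
  proof -
    from that obtain m b x x' y y' where m: "m \<in> two_sender_MACs N A i j p"
      and xy: "b \<in> B" "x \<in> A i" "x' \<in> A i" "y \<in> A j" "y' \<in> A j"
      and s: "s = \<bar>m x y b + m x' y' b - m x y' b - m x' y b\<bar>"
      unfolding S_def by blast
    from m obtain c where c: "c \<in> (\<Pi>\<^sub>E k\<in>{1..N} - {i, j}. A k)"
      and mc: "\<And>x y. x \<in> A i \<Longrightarrow> y \<in> A j \<Longrightarrow> m x y = p (c(i := x, j := y))"
      by (rule two_sender_MACs_apply) blast
    have "m u v b = g b i u + g b j v + (\<Sum>k\<in>{1..N} - {i, j}. g b k (c k))"
      if uv: "u \<in> A i" "v \<in> A j" for u v
    proof -
      have "c(i := u, j := v) \<in> inputs N A"
        using c uv ij by (auto simp: inputs_def PiE_iff extensional_def)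
      then have "m u v b = (\<Sum>k=1..N. g b k ((c(i := u, j := v)) k))"
        using mc[OF uv] add xy by simp
      also have "{1..N} = insert i (insert j ({1..N} - {i, j}))"
        using ij by auto
      also have "(\<Sum>k\<in>\<dots>. g b k ((c(i := u, j := v)) k))
          = g b i u + g b j v + (\<Sum>k\<in>{1..N} - {i, j}. g b k ((c(i := u, j := v)) k))"
        using ij by simp
      also have "(\<Sum>k\<in>{1..N} - {i, j}. g b k ((c(i := u, j := v)) k))
          = (\<Sum>k\<in>{1..N} - {i, j}. g b k (c k))"
        by (rule sum.cong) auto
      finally show ?thesis .
    qed
    then show "s = 0"
      using s xy by simp
  qed
  \<comment> \<open>\<open>Max\<close> of the empty set is unspecified, so the maximum is 0 only
    once some value is known to occur.\<close>
  moreover have "S \<noteq> {}"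
  proof -
    have "(\<Pi>\<^sub>E k\<in>{1..N} - {i, j}. A k) \<noteq> {}"
      using A by (subst PiE_eq_empty_iff) auto
    then have "two_sender_MACs N A i j p \<noteq> {}"
      unfolding two_sender_MACs_def by blast
    then show ?thesis
      using A[OF ij(1)] A[OF ij(2)] \<open>B \<noteq> {}\<close> unfolding S_def by blast
  qed
  ultimately have "S = {0}" by blast
  then show ?thesis
    unfolding I2_def S_def by simp
qed

text \<open>Finiteness makes \<open>Max\<close> an upper bound, so a zero maximum of absolute values
  forces each of them to vanish. Taking \<open>c i\<close> and \<open>c j\<close> as the second pair
  of inputs gives the form with a base point that the telescoping argument uses.\<close>

lemma mixed_difference_eq_0_if_I2_eq_0:
  assumes I2: "I2 N A B i j p = 0"
    and ij: "i \<in> {1..N}" "j \<in> {1..N}" "i \<noteq> j"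
    and fin: "\<And>k. k \<in> {1..N} \<Longrightarrow> finite (A k)" "finite B"
    and c: "c \<in> inputs N A" and "x \<in> A i" "y \<in> A j" "b \<in> B"
  shows "p (c(i := x, j := y)) b + p c b = p (c(i := x)) b + p (c(j := y)) b"
proof -
  let ?S = "{\<bar>m x y b + m x' y' b - m x y' b - m x' y b\<bar> | m b x x' y y'.
     m \<in> two_sender_MACs N A i j p \<and> b \<in> B \<and> x \<in> A i \<and> x' \<in> A i \<and> y \<in> A j \<and> y' \<in> A j}"
  let ?T = "two_sender_MACs N A i j p"
  have "finite ?T"
    unfolding two_sender_MACs_def Setcompr_eq_image
    using fin by (intro finite_imageI finite_PiE) auto
  moreover have "?S \<subseteq> (\<lambda>(m, b, x, x', y, y'). \<bar>m x y b + m x' y' b - m x y' b - m x' y b\<bar>) `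
      (?T \<times> B \<times> A i \<times> A i \<times> A j \<times> A j)"
    by force
  ultimately have finS: "finite ?S"
    using fin ij by (elim finite_subset) auto
  \<comment> \<open>Fixed inputs are extensional on the remaining senders; the restriction loses
    nothing, since \<open>i\<close> and \<open>j\<close> are overwritten anyway.\<close>
  define c' where "c' = restrict c ({1..N} - {i, j})"
  define m where "m = (\<lambda>x\<in>A i. \<lambda>y\<in>A j. p (c'(i := x, j := y)))"
  have c': "c' \<in> (\<Pi>\<^sub>E k\<in>{1..N} - {i, j}. A k)"
    using c by (auto simp: c'_def inputs_def)
  have cA: "c i \<in> A i" "c j \<in> A j"
    using c ij by (simp_all add: inputs_def PiE_iff)
  have "m \<in> ?T"
    using c' unfolding two_sender_MACs_def m_def by blast
  then have "\<bar>m x y b + m (c i) (c j) b - m x (c j) b - m (c i) y b\<bar> \<in> ?S"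
    unfolding mem_Collect_eq using \<open>x \<in> A i\<close> \<open>y \<in> A j\<close> \<open>b \<in> B\<close> cA
    by (intro exI[of _ m] exI[of _ b] exI[of _ x] exI[of _ "c i"] exI[of _ y] exI[of _ "c j"]) simp
  then have "\<bar>m x y b + m (c i) (c j) b - m x (c j) b - m (c i) y b\<bar> \<le> I2 N A B i j p"
    unfolding I2_def by (rule Max_ge[OF finS])
  moreover have "m u v = p (c(i := u, j := v))" if "u \<in> A i" "v \<in> A j" for u v
  proof -
    have "c'(i := u, j := v) = c(i := u, j := v)"
      using c by (auto simp: c'_def fun_eq_iff inputs_def PiE_iff extensional_def)
    then show ?thesis
      using that by (simp add: m_def)
  qed
  moreover have "c(i := x, j := c j) = c(i := x)" "c(i := c i, j := y) = c(j := y)"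
    using ij by (auto simp: fun_eq_iff)
  ultimately show ?thesis
    using I2 cA assms by simp
qed

lemma local_MAC_if_additive:
  assumes p: "p \<in> MACs N A {0, 1 :: nat}" and "N \<ge> 1"
    and A: "\<And>i. i \<in> {1..N} \<Longrightarrow> finite (A i) \<and> A i \<noteq> {}"
    and "0 \<le> m"
    and h: "\<And>i x. i \<in> {1..N} \<Longrightarrow> x \<in> A i \<Longrightarrow> 0 \<le> h i x"
    and add: "\<And>a. a \<in> inputs N A \<Longrightarrow> p a 1 = m + (\<Sum>i=1..N. h i (a i))"
  shows "p \<in> local_MACs N A {0, 1 :: nat}"
proof -
  have p01: "0 \<le> p a 0" "p a 0 + p a 1 = 1" if "a \<in> inputs N A" for a
    using p that by (auto simp: MACs_def stochastic_maps_def prob_dists_def PiE_iff)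
  define M where "M i = Max (h i ` A i)" for i
  define k where "k i = (if i = 1 then m else 0)" for i :: nat
  \<comment> \<open>By \<open>mM\<close> below, the leftover weight
    \<open>1 - (\<Sum>i=1..N. M i)\<close> is at least \<open>m\<close>, so path 1 can carry both
    \<open>M 1\<close> and the constant.\<close>
  define w where "w = (\<lambda>i\<in>{1..N}. M i + (if i = 1 then 1 - (\<Sum>i=1..N. M i) else 0))"
  have hM: "h i x \<le> M i" if "i \<in> {1..N}" "x \<in> A i" for i x
    unfolding M_def using A that by (intro Max_ge) auto
  have M0: "0 \<le> M i" if "i \<in> {1..N}" for i
    using A[OF that] h[OF that] hM[OF that] by (meson all_not_in_conv order_trans)
  have "\<exists>x\<in>A i. h i x = M i" if "i \<in> {1..N}" for i
  proof -
    have "M i \<in> h i ` A i"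
      unfolding M_def using A[OF that] by (intro Max_in) auto
    then show ?thesis by auto
  qed
  then obtain z where z: "\<And>i. i \<in> {1..N} \<Longrightarrow> z i \<in> A i \<and> h i (z i) = M i"
    by metis
  \<comment> \<open>The senders choose inputs independently, so the maximisers \<open>z i\<close>
    form one admissible input, and the probability there being at most 1 yields
    \<open>mM\<close>.\<close>
  have z_in: "restrict z {1..N} \<in> inputs N A"
    using z by (auto simp: inputs_def)
  have "m + (\<Sum>i=1..N. h i (restrict z {1..N} i)) \<le> 1"
    using add[OF z_in] p01[OF z_in] by linarith
  then have mM: "m + (\<Sum>i=1..N. M i) \<le> 1"
    using z by simp
  have w1: "(\<Sum>i=1..N. w i) = 1"
    using \<open>N \<ge> 1\<close> by (simp add: w_def sum.distrib)
  have w0: "0 \<le> w i" if "i \<in> {1..N}" for i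
    using M0[OF that] mM \<open>0 \<le> m\<close> that by (auto simp: w_def)
  have w: "w \<in> prob_dists {1..N}"
    using w0 w1 by (auto simp: prob_dists_def w_def)
  have hw0: "0 \<le> h i x + k i" and hw: "h i x + k i \<le> w i" if "i \<in> {1..N}" "x \<in> A i" for i x
    using h[OF that] hM[OF that] mM \<open>0 \<le> m\<close> that by (auto simp: w_def k_def)
  \<comment> \<open>If \<open>w i = 0\<close>, then \<open>h i x + k i = 0\<close> as well, so division by zero is harmless.\<close>
  define r where "r i x = (h i x + k i) / w i" for i x
  have r: "0 \<le> r i x" "r i x \<le> 1" "w i * r i x = h i x + k i" if "i \<in> {1..N}" "x \<in> A i" for i x
    using hw0[OF that] hw[OF that] by (auto simp: r_def divide_le_eq_1)
  \<comment> \<open>Sender \<open>i\<close> lets the particle pass with probability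
    \<open>r i x\<close>, so path \<open>i\<close> contributes
    \<open>w i * r i x = h i x + k i\<close> to outcome 1.\<close>
  define q where "q i = (\<lambda>x\<in>A i. \<lambda>s\<in>{Vac, Path i}. if s = Vac then 1 - r i x else r i x)" for i
  define d where "d = (\<lambda>s\<in>insert Vac (Path ` {1..N}). \<lambda>b\<in>{0, 1 :: nat}.
    if (s = Vac) = (b = 0) then 1 else 0 :: real)"
  have q: "q i \<in> stochastic_maps (A i) {Vac, Path i}" if "i \<in> {1..N}" for i
    using r[OF that] by (auto simp: q_def stochastic_maps_def prob_dists_def)
  have d: "d \<in> stochastic_maps (insert Vac (Path ` {1..N})) {0, 1}"
    by (auto simp: d_def stochastic_maps_def prob_dists_def)
  have "p a b = (\<Sum>i=1..N. w i * (d Vac b * q i (a i) Vac + d (Path i) b * q i (a i) (Path i)))"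
    if a: "a \<in> inputs N A" and b: "b \<in> {0, 1}" for a b
  proof -
    have aA: "a i \<in> A i" if "i \<in> {1..N}" for i
      using a that unfolding inputs_def by (rule PiE_mem)
    have p1: "p a 1 = (\<Sum>i=1..N. w i * r i (a i))"
      using add[OF a] aA r(3) \<open>N \<ge> 1\<close> by (simp add: sum.distrib k_def)
    show ?thesis
    proof (cases "b = 0")
      case True
      have "p a b = (\<Sum>i=1..N. w i) - (\<Sum>i=1..N. w i * r i (a i))"
        using p01(2)[OF a] w1 p1 True by simp
      also have "\<dots> = (\<Sum>i=1..N. w i * (1 - r i (a i)))"
        by (simp add: sum_subtractf algebra_simps)
      also have "\<dots> = (\<Sum>i=1..N. w i * (d Vac b * q i (a i) Vac + d (Path i) b * q i (a i) (Path i)))"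
        using True aA by (intro sum.cong) (auto simp: d_def q_def)
      finally show ?thesis .
    next
      case False
      then have "b = 1" using b by simp
      then show ?thesis
        unfolding p1[folded \<open>b = 1\<close>] using aA by (intro sum.cong) (auto simp: d_def q_def)
    qed
  qed
  then show ?thesis
    unfolding local_MACs_def using p w q d by blast
qed

theorem corollary1:
  fixes N :: nat and A :: "nat \<Rightarrow> 'a set"
  assumes "N \<ge> 1"
    and "\<And>i. i \<in> {1..N} \<Longrightarrow> finite (A i) \<and> A i \<noteq> {}"
  shows "local_MACs N A {0, 1 :: nat} = no_interference_MACs N A {0, 1}"
proof (intro equalityI subsetI)
  fix p assume "p \<in> local_MACs N A {0, 1 :: nat}"
  then obtain w q d where p: "p \<in> MACs N A {0, 1}"
    and eq: "\<forall>a\<in>inputs N A. \<forall>b\<in>{0, 1}.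
        p a b = (\<Sum>i=1..N. w i * (d Vac b * q i (a i) Vac + d (Path i) b * q i (a i) (Path i)))"
    unfolding local_MACs_def by blast
  \<comment> \<open>The term of path \<open>i\<close> in the single-particle formula depends on
    \<open>a i\<close> alone, so the formula is already additive.\<close>
  have "I2 N A {0, 1} i j p = 0" if "i \<in> {1..N}" "j \<in> {1..N}" "i \<noteq> j" for i j
    by (rule I2_eq_0_if_additive[where
          g = "\<lambda>b i x. w i * (d Vac b * q i x Vac + d (Path i) b * q i x (Path i))"])
      (use eq that assms in auto)
  with p show "p \<in> no_interference_MACs N A {0, 1}"
    by (simp add: no_interference_MACs_def)
next
  fix p assume "p \<in> no_interference_MACs N A {0, 1 :: nat}"
  then have p: "p \<in> MACs N A {0, 1}"
    and I2: "\<And>i j. i \<in> {1..N} \<Longrightarrow> j \<in> {1..N} \<Longrightarrow> i \<noteq> j \<Longrightarrow> I2 N A {0, 1} i j p = 0"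
    by (auto simp: no_interference_MACs_def)
  \<comment> \<open>Outcome 1 suffices, since normalisation determines the probability of outcome
    0.\<close>
  have mixed: "p (c(i := x, j := y)) 1 + p c 1 = p (c(i := x)) 1 + p (c(j := y)) 1"
    if "c \<in> inputs N A" "i \<in> {1..N}" "j \<in> {1..N}" "i \<noteq> j" "x \<in> A i" "y \<in> A j" for c i j x y
    by (rule mixed_difference_eq_0_if_I2_eq_0[OF I2]) (use that assms in auto)
  have "finite (inputs N A)"
    unfolding inputs_def using assms by (intro finite_PiE) auto
  moreover have "inputs N A \<noteq> {}"
    unfolding inputs_def using assms by (subst PiE_eq_empty_iff) auto
  ultimately obtain e where e: "e \<in> inputs N A"
    and min: "\<And>a. a \<in> inputs N A \<Longrightarrow> p e 1 \<le> p a 1"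
    using ex_min_if_finite[of "(\<lambda>a. p a 1) ` inputs N A"] by (auto simp: not_less)
  show "p \<in> local_MACs N A {0, 1}"
  proof (rule local_MAC_if_additive[OF p assms])
    show "0 \<le> p e 1"
      using p e by (auto simp: MACs_def stochastic_maps_def prob_dists_def PiE_iff)
    \<comment> \<open>Here \<open>h i x\<close> is the increment from replacing coordinate
      \<open>i\<close> of the minimiser \<open>e\<close> by \<open>x\<close>.\<close>
    show "0 \<le> p (e(i := x)) 1 - p e 1" if "i \<in> {1..N}" "x \<in> A i" for i x
    proof -
      have "e(i := x) \<in> inputs N A"
        using e that by (auto simp: inputs_def PiE_iff extensional_def)
      from min[OF this] show ?thesis by simp
    qed
    show "p a 1 = p e 1 + (\<Sum>i=1..N. p (e(i := a i)) 1 - p e 1)" if "a \<in> inputs N A" for a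
      using vanishing_mixed_differences_imp_additive[of "{1..N}" A "\<lambda>a. p a 1" a e] mixed that e
      unfolding inputs_def by blast
  qed
qed

end
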